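(* For every integer $K\ge1$ there exists an angle $\theta^*(K)$ such that the following hold. (1) If $0<\theta_0<\theta^*(K)$, then for every $h\ge0$, every balanced initial configuration $\eta_0$ and every $x_0$ such that $(x_0,\eta_0,\theta_0)\in B_h^*$, the configuration $\eta_t$ is balanced for every $t\ge0$. (2) Moreover, if $0<\theta_0<\theta^*(K)$, then for every $h\ge0$, every well-filled initial configuration $\eta_0$ and every $x_0$ such that $(x_0,\eta_0,\theta_0)\in B_h^*$, there exists $t_0>0$, depending only on the highest empty cell, i.e. on $H^+(\eta_0)$, such that the configuration $\eta_{t_0}$ is balanced. One can take $\theta^*(K)=\arctan\frac{1}{K(K-1)}$ (read as $\pi/2$ for $K=1$), and so in particular $\theta^*(2)=\arctan\frac12$.
   Context: Fix an integer $K\ge1$. For $h\ge0$ let $\Delta_h=\{x\in\mathbb R^2: 0\le x_1\le K,\ x_2\ge -h\}$. Let $\mathcal Z_K=\{0,\dots,K-1\}\times\mathbb Z_{\ge0}$; the brick at $z\in\mathcal Z_K$ is $\square_z=[z_1,z_1+1]\times[z_2,z_2+1]$. A configuration is $\eta\in\{0,1\}^{\mathcal Z_K}$; the brick $\square_z$ is present iff $\eta(z)=1$. It is well-filled if $\eta(z)=0$ for only finitely many $z$; all configurations considered are well-filled. Let $\Delta_h^\eta$ be the closure of $\Delta_h$ minus the union of the present bricks. A state is a triple $(x,\eta,\theta)$ with $\eta$ well-filled, $x\in\Delta_h^\eta$, $\theta\in\mathbb R/2\pi\mathbb Z$; its velocity is $v(\theta)=(\cos\theta,\sin\theta)$. It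 is admissible if $x+s\,v(\theta)\in\operatorname{int}(\Delta_h^\eta)$ for all sufficiently small $s>0$. Semi-flow $\Phi^h_t$: the point moves in a straight line with unit velocity in $\Delta_h^\eta$. When (at a positive time) it hits the boundary of $\Delta_h^\eta$ at a point which is neither a vertex of $\Delta_h$ nor a vertex of a present brick, its velocity is reflected specularly; if the point hit belongs to a present brick, that brick is moreover removed from the configuration at that instant; otherwise the configuration is unchanged. The motion then continues in the new domain. An admissible state is regular if its trajectory never reaches, at a positive time, a vertex of $\Delta_h$ or of a brick present just before that time; then the trajectory $(x_t,\eta_t,\theta_t)=\Phi^h_t(x_0,\eta_0,\theta_0)$ is defined for all $t\ge0$. $B_h^*$ is the set of regular admissible states with $x_2=-h$ and $\theta\in(0,\pi)$. For well-filled $\eta$: $H(\eta)=\min\{z_2:\eta(z_1,z_2)=1\}$ is the height of the lowest present brick and $H^+(\eta)=1+\max\{z_2:\eta(z_1,z_2)=0\}$ is the height just above the highest empty cell (with $H^+=0$ if no brick is missing). $\eta$ is balanced if $H^+(\eta)-H(\eta)\le1$.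
   Formalization: In part (2) the time t_0 may depend on K, h and θ_0 as well as on H^+(η_0); it is uniform over all η_0 with the same H^+ and all x_0. Literal dependence on H^+ alone fails: for h > t_0 an unbalanced configuration is still untouched at time t_0. *)

theory Defs
  imports "HOL-Analysis.Analysis"
begin

text \<open>
  Angles in \<open>\<real>/2\<pi>\<int>\<close> are represented by real numbers. The dynamics uses an angle only through
  its velocity vector, so it does not depend on the chosen representative.
  Values of a configuration outside \<open>cells K\<close> are irrelevant to every notion below.
\<close>

type_synonym config = "nat \<times> nat \<Rightarrow> bool"
type_synonym state = "(real \<times> real) \<times> config \<times> real"

definition cells :: "nat \<Rightarrow> (nat \<times> nat) set" where
  "cells K = {..<K} \<times> UNIV"

definition brick :: "nat \<times> nat \<Rightarrow> (real \<times> real) set" where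
  "brick z = {real (fst z)..real (fst z) + 1} \<times> {real (snd z)..real (snd z) + 1}"

definition brick_vertices :: "nat \<times> nat \<Rightarrow> (real \<times> real) set" where
  "brick_vertices z = {real (fst z), real (fst z) + 1} \<times> {real (snd z), real (snd z) + 1}"

definition present :: "nat \<Rightarrow> config \<Rightarrow> (nat \<times> nat) set" where
  "present K \<eta> = {z \<in> cells K. \<eta> z}"

definition missing :: "nat \<Rightarrow> config \<Rightarrow> (nat \<times> nat) set" where
  "missing K \<eta> = {z \<in> cells K. \<not> \<eta> z}"

definition well_filled :: "nat \<Rightarrow> config \<Rightarrow> bool" where
  "well_filled K \<eta> \<longleftrightarrow> finite (missing K \<eta>)"

definition strip :: "nat \<Rightarrow> real \<Rightarrow> (real \<times> real) set" where
  "strip K h = {x. 0 \<le> fst x \<and> fst x \<le> real K \<and> - h \<le> snd x}"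

definition strip_vertices :: "nat \<Rightarrow> real \<Rightarrow> (real \<times> real) set" where
  "strip_vertices K h = {(0, - h), (real K, - h)}"

definition table :: "nat \<Rightarrow> real \<Rightarrow> config \<Rightarrow> (real \<times> real) set" where
  "table K h \<eta> = closure (strip K h - (\<Union>z\<in>present K \<eta>. brick z))"

definition velocity :: "real \<Rightarrow> real \<times> real" where
  "velocity \<theta> = (cos \<theta>, sin \<theta>)"

fun admissible :: "nat \<Rightarrow> real \<Rightarrow> state \<Rightarrow> bool" where
  "admissible K h (x, \<eta>, \<theta>) \<longleftrightarrow>
     well_filled K \<eta> \<and> x \<in> table K h \<eta> \<and>
     (\<forall>\<^sub>F s in at_right 0. x + s *\<^sub>R velocity \<theta> \<in> interior (table K h \<eta>))"

text \<open>
  For an admissible state the set below is nonempty and its infimum is attained and positive.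
\<close>

fun hit_time :: "nat \<Rightarrow> real \<Rightarrow> state \<Rightarrow> real" where
  "hit_time K h (x, \<eta>, \<theta>) = Inf {s. 0 < s \<and> x + s *\<^sub>R velocity \<theta> \<in> frontier (table K h \<eta>)}"

fun hit_point :: "nat \<Rightarrow> real \<Rightarrow> state \<Rightarrow> real \<times> real" where
  "hit_point K h (x, \<eta>, \<theta>) = x + hit_time K h (x, \<eta>, \<theta>) *\<^sub>R velocity \<theta>"

fun hits_vertex :: "nat \<Rightarrow> real \<Rightarrow> state \<Rightarrow> bool" where
  "hits_vertex K h (x, \<eta>, \<theta>) \<longleftrightarrow>
     hit_point K h (x, \<eta>, \<theta>) \<in> strip_vertices K h \<union> (\<Union>z\<in>present K \<eta>. brick_vertices z)"

text \<open>
  A boundary point that is no vertex lies either only on horizontal sides (the floor, or the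
  bottom or top side of a present brick) or only on vertical ones.
\<close>

definition on_horizontal_side :: "nat \<Rightarrow> real \<Rightarrow> config \<Rightarrow> real \<times> real \<Rightarrow> bool" where
  "on_horizontal_side K h \<eta> y \<longleftrightarrow>
     snd y = - h \<or> (\<exists>z\<in>present K \<eta>. y \<in> brick z \<and> snd y \<in> {real (snd z), real (snd z) + 1})"

text \<open>
  Specular reflection is \<open>\<theta> \<mapsto> -\<theta>\<close> at a horizontal side and \<open>\<theta> \<mapsto> \<pi> - \<theta>\<close> at a vertical one.
  A boundary point of the table that is no vertex belongs to at most one present brick, so at
  most one brick is removed. The result is meaningful only if no vertex is hit.
\<close>

fun bounce :: "nat \<Rightarrow> real \<Rightarrow> state \<Rightarrow> state" where
  "bounce K h (x, \<eta>, \<theta>) =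
     (let y = hit_point K h (x, \<eta>, \<theta>)
      in (y, \<lambda>z. \<eta> z \<and> y \<notin> brick z, if on_horizontal_side K h \<eta> y then - \<theta> else pi - \<theta>))"

definition after_bounces :: "nat \<Rightarrow> real \<Rightarrow> state \<Rightarrow> nat \<Rightarrow> state" where
  "after_bounces K h S n = (bounce K h ^^ n) S"

definition bounce_time :: "nat \<Rightarrow> real \<Rightarrow> state \<Rightarrow> nat \<Rightarrow> real" where
  "bounce_time K h S n = (\<Sum>i<n. hit_time K h (after_bounces K h S i))"

text \<open>
  At a bounce time the flow takes the value after the collision: the velocity is already
  reflected, and a brick that was hit is already removed.
\<close>

definition flow :: "nat \<Rightarrow> real \<Rightarrow> real \<Rightarrow> state \<Rightarrow> state" where
  "flow K h t S =
     (let n = (LEAST n. t < bounce_time K h S (Suc n));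
          (x, \<eta>, \<theta>) = after_bounces K h S n
      in (x + (t - bounce_time K h S n) *\<^sub>R velocity \<theta>, \<eta>, \<theta>))"

definition config_at :: "nat \<Rightarrow> real \<Rightarrow> real \<Rightarrow> state \<Rightarrow> config" where
  "config_at K h t S = fst (snd (flow K h t S))"

text \<open>
  Between bounces the trajectory stays in the interior of the table, which contains no vertex of
  the strip or of a present brick, so vertices can only be reached at hits.
\<close>

definition regular :: "nat \<Rightarrow> real \<Rightarrow> state \<Rightarrow> bool" where
  "regular K h S \<longleftrightarrow> admissible K h S \<and> (\<forall>n. \<not> hits_vertex K h (after_bounces K h S n))"

definition B_star :: "nat \<Rightarrow> real \<Rightarrow> state set" where
  "B_star K h = {(x, \<eta>, \<theta>). regular K h (x, \<eta>, \<theta>) \<and> snd x = - h \<and> 0 < \<theta> \<and> \<theta> < pi}"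

definition lowest_brick :: "nat \<Rightarrow> config \<Rightarrow> nat" where
  "lowest_brick K \<eta> = Inf (snd ` present K \<eta>)"

definition highest_gap :: "nat \<Rightarrow> config \<Rightarrow> nat" where
  "highest_gap K \<eta> = (if missing K \<eta> = {} then 0 else 1 + Max (snd ` missing K \<eta>))"

definition balanced :: "nat \<Rightarrow> config \<Rightarrow> bool" where
  "balanced K \<eta> \<longleftrightarrow> well_filled K \<eta> \<and> int (highest_gap K \<eta>) - int (lowest_brick K \<eta>) \<le> 1"

end

theory Submission imports Defs begin

text \<open>
  Bounces only change the signs of the components of the velocity, so the ball always moves along
  lines of slope \<open>\<plusminus> tan \<theta>0\<close>. The main point is that a shot with \<open>tan \<theta>0 < 1 / (K (K - 1))\<close>
  (no condition if \<open>K = 1\<close>) clears the bricks row by row. Let \<open>H\<close> be the lowest nonempty row. When the ball comes up from below, it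
  either hits the bottom of a brick of row \<open>H\<close> and falls back, or it enters the row through a
  gap. In the second case it runs to and fro between bricks and walls. If the missing bricks have
  total width \<open>w\<close>, the next brick is destroyed after a horizontal distance of at most \<open>2 * w\<close>,
  because at most one wall is accessible while the row is nonempty. Summing \<open>2 * w\<close> over
  \<open>w = 1, \<dots>, K - 1\<close> gives \<open>K * (K - 1)\<close>, and over this distance the ball rises by less than 1. So row
  \<open>H\<close> is empty before the ball can leave it through the top. The predicate \<open>confined\<close> expresses this
  budget as an invariant of the bounces (\<open>end_up\<close>, \<open>confined_bounce\<close>).

  Consequently bricks are only ever removed from the lowest nonempty row. Thus the highest gap is
  never above \<open>max (H\<^sup>+(\<eta>0)) (H + 1)\<close> (\<open>highest_gap_conf\<close>), while \<open>H\<close> never decreases. This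
  yields the first part at once, and it shows that the configuration is balanced as soon as
  \<open>H \<ge> H\<^sup>+(\<eta>0)\<close>.

  It remains to bound the time until then. The vertical speed is constant, so a trip from the
  floor up to row \<open>H\<close> and back takes a time proportional to its height, and it ends only by
  removing a brick; since there are at most \<open>K * m\<close> bricks in the rows below \<open>m = H\<^sup>+(\<eta>0)\<close>, the time
  spent with \<open>H < m\<close> is bounded in terms of \<open>m\<close> (\<open>clearing_time\<close>). Both this and the fact that bounces
  do not accumulate in finite time, without which the flow would not be given by its defining
  formula for all times (\<open>bounce_times_unbounded\<close>), are obtained from additive
  functions of the state whose change in a bounce is controlled.
\<close>

section \<open>The table and the first hit\<close>

abbreviation bricks :: "nat \<Rightarrow> config \<Rightarrow> (real \<times> real) set" where
  "bricks K \<eta> \<equiv> \<Union>z\<in>present K \<eta>. brick z"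

lemma mem_brick:
  "(a, b) \<in> brick (i, j) \<longleftrightarrow> real i \<le> a \<and> a \<le> real i + 1 \<and> real j \<le> b \<and> b \<le> real j + 1"
  by (auto simp: brick_def)

lemma closed_brick: "closed (brick z)"
  by (simp add: brick_def closed_Times)

text \<open>
  Any set of bricks, finite or not, has a closed union because bricks sit on the integer grid:
  near a given point only finitely many of them matter.
\<close>
lemma closed_Union_brick: "closed (\<Union>z\<in>P. brick z)"
proof -
  have "\<exists>T. open T \<and> p \<in> T \<and> T \<subseteq> - (\<Union>z\<in>P. brick z)" if p: "p \<notin> (\<Union>z\<in>P. brick z)" for p
  proof -
    obtain a b where ab: "p = (a, b)" by fastforce
    define F where "F = P \<inter> {..nat \<lceil>a + 1\<rceil>} \<times> {..nat \<lceil>b + 1\<rceil>}"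
    define T where "T = {..<a + 1} \<times> {..<b + 1} - (\<Union>z\<in>F. brick z)"
    have "closed (\<Union>z\<in>F. brick z)"
      by (intro closed_UN ballI closed_brick) (simp add: F_def)
    then have "open T"
      unfolding T_def by (intro open_Diff open_Times) auto
    moreover have "p \<in> T"
      using p by (auto simp: T_def F_def ab)
    moreover have "T \<subseteq> - (\<Union>z\<in>P. brick z)"
    proof
      fix q assume q: "q \<in> T"
      obtain u v where uv: "q = (u, v)" by fastforce
      have "q \<notin> brick z" if "z \<in> P" for z
      proof
        assume z: "q \<in> brick z"
        obtain i j where ij: "z = (i, j)" by fastforce
        have "real i \<le> a + 1" "real j \<le> b + 1"
          using z q by (auto simp: uv ij mem_brick T_def)
        then have "i \<le> nat \<lceil>a + 1\<rceil>" "j \<le> nat \<lceil>b + 1\<rceil>" by linarith+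
        then have "z \<in> F" using that by (simp add: F_def ij)
        then show False using z q by (auto simp: T_def)
      qed
      then show "q \<in> - (\<Union>z\<in>P. brick z)" by blast
    qed
    ultimately show ?thesis by blast
  qed
  then have "open (- (\<Union>z\<in>P. brick z))"
    by (subst open_subopen) blast
  then show ?thesis by (simp add: closed_open)
qed

lemma closed_strip: "closed (strip K h)"
proof -
  have "strip K h = {0..real K} \<times> {-h..}"
    by (auto simp: strip_def)
  then show ?thesis by (simp add: closed_Times)
qed

lemma interior_strip:
  "interior (strip K h) = {p. 0 < fst p \<and> fst p < real K \<and> - h < snd p}"
proof -
  have "strip K h = {0..real K} \<times> {-h..}"
    by (auto simp: strip_def)
  then show ?thesis by (auto simp: interior_Times)
qed

lemma table_subset_strip: "table K h \<eta> \<subseteq> strip K h"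
  unfolding table_def by (intro closure_minimal closed_strip) auto

text \<open>
  Taking the closure in the definition of the table does not bring back any point of a brick into
  the interior, because a brick is the closure of its own interior.
\<close>
lemma interior_table:
  "interior (table K h \<eta>) = {p. 0 < fst p \<and> fst p < real K \<and> - h < snd p} - bricks K \<eta>"
proof
  show "interior (table K h \<eta>) \<subseteq> {p. 0 < fst p \<and> fst p < real K \<and> - h < snd p} - bricks K \<eta>"
  proof -
    have "interior (table K h \<eta>) \<inter> brick z = {}" if z: "z \<in> present K \<eta>" for z
    proof -
      have reg: "brick z = closure (interior (brick z))"
        by (simp add: brick_def interior_Times closure_Times)
      have "interior (brick z) \<inter> (strip K h - bricks K \<eta>) = {}"
        using z interior_subset[of "brick z"] by blast
      then have "interior (brick z) \<inter> table K h \<eta> = {}"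
        unfolding table_def using open_Int_closure_eq_empty[OF open_interior] by blast
      then have "interior (table K h \<eta>) \<inter> interior (brick z) = {}"
        using interior_subset[of "brick z"] interior_subset[of "table K h \<eta>"] by blast
      then have "interior (table K h \<eta>) \<inter> closure (interior (brick z)) = {}"
        using open_Int_closure_eq_empty[OF open_interior] by blast
      then show ?thesis using reg by simp
    qed
    moreover have "interior (table K h \<eta>) \<subseteq> interior (strip K h)"
      by (intro interior_mono table_subset_strip)
    ultimately show ?thesis by (auto simp: interior_strip)
  qed
  show "{p. 0 < fst p \<and> fst p < real K \<and> - h < snd p} - bricks K \<eta> \<subseteq> interior (table K h \<eta>)"
  proof (rule interior_maximal)
    show "{p. 0 < fst p \<and> fst p < real K \<and> - h < snd p} - bricks K \<eta> \<subseteq> table K h \<eta>"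
      unfolding table_def by (rule order_trans[OF _ closure_subset]) (auto simp: strip_def)
    show "open ({p. 0 < fst p \<and> fst p < real K \<and> - h < snd p} - bricks K \<eta>)"
      unfolding interior_strip[symmetric] by (intro open_Diff open_interior closed_Union_brick)
  qed
qed

lemma frontier_tableD:
  assumes "p \<in> frontier (table K h \<eta>)"
  shows "p \<in> strip K h"
    and "fst p = 0 \<or> fst p = real K \<or> snd p = - h \<or> p \<in> bricks K \<eta>"
proof -
  have "closed (table K h \<eta>)" by (simp add: table_def)
  then have p: "p \<in> table K h \<eta>" "p \<notin> interior (table K h \<eta>)"
    using assms by (auto simp: frontier_def)
  show s: "p \<in> strip K h" by (rule subsetD[OF table_subset_strip p(1)])
  then show "fst p = 0 \<or> fst p = real K \<or> snd p = - h \<or> p \<in> bricks K \<eta>"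
    using p(2) by (auto simp: interior_table strip_def)
qed

text \<open>
  The hitting time is a genuine first exit. The set of frontier times is nonempty since a
  non-vertical ray leaves the strip, and admissibility keeps it away from \<open>0\<close>, so its
  infimum is attained. Before that time the ray stays inside, since a connected set cannot leave
  the table without meeting its frontier.
\<close>
lemma first_hit:
  fixes p :: "real \<times> real"
  assumes adm: "admissible K h (p, \<eta>, \<theta>)" and cos: "cos \<theta> \<noteq> 0"
  defines "\<tau> \<equiv> hit_time K h (p, \<eta>, \<theta>)"
  shows "0 < \<tau>"
    and "\<And>s. 0 < s \<Longrightarrow> s < \<tau> \<Longrightarrow> p + s *\<^sub>R velocity \<theta> \<in> interior (table K h \<eta>)"
    and "p + \<tau> *\<^sub>R velocity \<theta> \<in> frontier (table K h \<eta>)"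
proof -
  define \<gamma> where "\<gamma> s = p + s *\<^sub>R velocity \<theta>" for s
  define D where "D = table K h \<eta>"
  have cont: "continuous_on A \<gamma>" for A
    unfolding \<gamma>_def by (intro continuous_intros)
  have "closed D" by (simp add: D_def table_def)
  have "\<forall>\<^sub>F s in at_right 0. \<gamma> s \<in> interior D"
    using adm by (simp add: \<gamma>_def D_def)
  then obtain e where e: "0 < e" "\<And>s. 0 < s \<Longrightarrow> s < e \<Longrightarrow> \<gamma> s \<in> interior D"
    unfolding eventually_at_right_field by auto
  have inside: "\<gamma> s \<in> interior D"
    if s: "0 < s" and no: "\<And>r. 0 < r \<Longrightarrow> r \<le> s \<Longrightarrow> \<gamma> r \<notin> frontier D" for s
  proof (rule ccontr)
    assume "\<gamma> s \<notin> interior D"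
    then have "\<gamma> s \<notin> D"
      using no[of s] s \<open>closed D\<close> by (auto simp: frontier_def)
    moreover have "\<gamma> (min s (e/2)) \<in> D" "min s (e/2) \<in> {0<..s}"
      using e(1) s by (auto intro!: subsetD[OF interior_subset e(2)])
    moreover have "connected (\<gamma> ` {0<..s})"
      by (intro connected_continuous_image cont) simp
    moreover have "\<gamma> s \<in> \<gamma> ` {0<..s}" using s by simp
    ultimately have "\<gamma> ` {0<..s} \<inter> frontier D \<noteq> {}"
      using connected_Int_frontier[of "\<gamma> ` {0<..s}" D] by blast
    then show False using no by auto
  qed
  define F where "F = {s. 0 < s \<and> \<gamma> s \<in> frontier D}"
  have \<tau>: "\<tau> = Inf F"
    unfolding \<tau>_def F_def D_def \<gamma>_def by simp
  \<comment> \<open>At the time \<open>t\<close> below, the ray has moved horizontally further than the strip is wide.\<close>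
  have "F \<noteq> {}"
  proof
    assume "F = {}"
    define t where "t = (real K + \<bar>fst p\<bar> + 1) / \<bar>cos \<theta>\<bar>"
    have "0 < t" using cos by (simp add: t_def add_nonneg_pos)
    then have "\<gamma> t \<in> interior D" using \<open>F = {}\<close> by (intro inside) (auto simp: F_def)
    then have "0 < fst p + t * cos \<theta>" "fst p + t * cos \<theta> < real K"
      by (auto simp: D_def interior_table \<gamma>_def velocity_def)
    moreover have "\<bar>t * cos \<theta>\<bar> = real K + \<bar>fst p\<bar> + 1"
      using cos by (simp add: t_def abs_mult)
    ultimately show False by linarith
  qed
  have F_alt: "F = {s. e \<le> s} \<inter> {s. \<gamma> s \<in> frontier D}"
    using e by (force simp: F_def frontier_def)
  have "closed F"
  proof -
    have "closed (\<gamma> -` frontier D)"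
      by (intro closed_vimage frontier_closed) (rule cont)
    then show ?thesis unfolding F_alt vimage_def
      by (intro closed_Int closed_Collect_le) auto
  qed
  moreover have bdd: "bdd_below F" by (auto simp: F_alt)
  ultimately have "Inf F \<in> F" using \<open>F \<noteq> {}\<close> by (intro closed_contains_Inf) auto
  then show "0 < \<tau>" "p + \<tau> *\<^sub>R velocity \<theta> \<in> frontier (table K h \<eta>)"
    by (auto simp: \<tau> F_def \<gamma>_def D_def)
  show "p + s *\<^sub>R velocity \<theta> \<in> interior (table K h \<eta>)" if "0 < s" "s < \<tau>" for s
  proof -
    have "\<gamma> s \<in> interior D"
    proof (rule inside[OF that(1)])
      fix r assume "0 < r" "r \<le> s"
      then show "\<gamma> r \<notin> frontier D"
        using cInf_lower[OF _ bdd, of r] that(2) by (auto simp: \<tau> F_def)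
    qed
    then show ?thesis by (simp add: \<gamma>_def D_def)
  qed
qed

text \<open>
  After a bounce no present brick contains the ball: every brick containing the hit point has been
  removed. Hence only the walls and the floor can obstruct the next flight.
\<close>
lemma inward_admissible:
  assumes K: "1 \<le> K" and wf: "well_filled K \<eta>"
    and p: "(x, y) \<in> strip K h" "(x, y) \<notin> bricks K \<eta>"
    and left: "0 < x \<or> 0 < cos \<theta>" and right: "x < real K \<or> cos \<theta> < 0"
    and floor: "- h < y \<or> 0 < sin \<theta>"
  shows "admissible K h ((x, y), \<eta>, \<theta>)"
proof -
  define \<gamma> where "\<gamma> s = (x, y) + s *\<^sub>R velocity \<theta>" for s
  have bnd: "0 \<le> x" "x \<le> real K" "- h \<le> y" using p by (auto simp: strip_def)
  have lim: "(\<gamma> \<longlongrightarrow> (x, y)) (at_right 0)"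
  proof -
    have "isCont \<gamma> 0" unfolding \<gamma>_def by (intro continuous_intros)
    then have "(\<gamma> \<longlongrightarrow> \<gamma> 0) (at 0)" by (simp add: isCont_def)
    then show ?thesis by (simp add: \<gamma>_def filterlim_at_split)
  qed
  have pos: "\<forall>\<^sub>F s in at_right 0. 0 < u + s * v" if "0 < u \<or> (u = 0 \<and> 0 < v)" for u v :: real
  proof (cases "0 < u")
    case True
    have "((\<lambda>s. u + s * v) \<longlongrightarrow> u + 0 * v) (at_right 0)"
      by (intro tendsto_intros)
    then show ?thesis using True order_tendstoD(1)[of _ u _ 0] by simp
  next
    case False
    then show ?thesis using that eventually_at_right_less[of "0::real"]
      by (auto elim!: eventually_mono)
  qed
  have "\<forall>\<^sub>F s in at_right 0. 0 < x + s * cos \<theta>"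
    using left bnd by (intro pos) auto
  moreover have "\<forall>\<^sub>F s in at_right 0. 0 < (real K - x) + s * (- cos \<theta>)"
    using right bnd by (intro pos) auto
  moreover have "\<forall>\<^sub>F s in at_right 0. 0 < (y + h) + s * sin \<theta>"
    using floor bnd by (intro pos) auto
  moreover have "\<forall>\<^sub>F s in at_right 0. \<gamma> s \<in> - bricks K \<eta>"
    by (rule topological_tendstoD[OF lim open_Compl[OF closed_Union_brick]]) (use p(2) in simp)
  ultimately have "\<forall>\<^sub>F s in at_right 0. \<gamma> s \<in> interior (table K h \<eta>)"
    by eventually_elim (auto simp: interior_table \<gamma>_def velocity_def)
  moreover have "(x, y) \<in> table K h \<eta>"
    unfolding table_def using p by (intro subsetD[OF closure_subset] DiffI)
  ultimately show ?thesis using wf by (simp add: \<gamma>_def)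
qed

section \<open>The lowest row of bricks\<close>

text \<open>
  An interval of a flight inside one row passes between the columns of the present bricks, hence
  it is no longer than the total width of the missing ones.
\<close>
lemma free_interval_length:
  fixes a b :: real
  assumes I: "I \<subseteq> {..<K}" and free: "\<And>i. i \<in> I \<Longrightarrow> real i + 1 \<le> a \<or> b \<le> real i"
    and "0 \<le> a" "a \<le> b" "b \<le> real K"
  shows "b - a \<le> real K - real (card I)"
proof -
  have "I \<subseteq> {..<nat \<lfloor>a\<rfloor>} \<union> {nat \<lceil>b\<rceil>..<K}"
  proof
    fix i assume i: "i \<in> I"
    then have "i < K" using I by auto
    moreover have "i < nat \<lfloor>a\<rfloor> \<or> nat \<lceil>b\<rceil> \<le> i"
      using free[OF i] \<open>0 \<le> a\<close> by linarith
    ultimately show "i \<in> {..<nat \<lfloor>a\<rfloor>} \<union> {nat \<lceil>b\<rceil>..<K}" by auto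
  qed
  then have "card I \<le> card ({..<nat \<lfloor>a\<rfloor>} \<union> {nat \<lceil>b\<rceil>..<K})"
    by (intro card_mono) auto
  also have "\<dots> \<le> nat \<lfloor>a\<rfloor> + (K - nat \<lceil>b\<rceil>)"
    using card_Un_le[of "{..<nat \<lfloor>a\<rfloor>}" "{nat \<lceil>b\<rceil>..<K}"] by simp
  finally have "real (card I) \<le> real (nat \<lfloor>a\<rfloor>) + real (K - nat \<lceil>b\<rceil>)" by linarith
  moreover have "real (nat \<lfloor>a\<rfloor>) \<le> a" using \<open>0 \<le> a\<close> by linarith
  moreover have "real (K - nat \<lceil>b\<rceil>) \<le> real K - b"
    using \<open>b \<le> real K\<close> by linarith
  ultimately show ?thesis by linarith
qed

definition lowest_row :: "nat \<Rightarrow> config \<Rightarrow> nat set" where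
  "lowest_row K \<eta> = {i. (i, lowest_brick K \<eta>) \<in> present K \<eta>}"

definition free_width :: "nat \<Rightarrow> config \<Rightarrow> real" where
  "free_width K \<eta> = real K - real (card (lowest_row K \<eta>))"

lemma missing_eq: "missing K \<eta> = cells K - present K \<eta>"
  by (auto simp: missing_def present_def)

lemma present_subset_cells: "present K \<eta> \<subseteq> cells K"
  by (auto simp: present_def)

lemma lowest_brick_le: "z \<in> present K \<eta> \<Longrightarrow> lowest_brick K \<eta> \<le> snd z"
  by (simp add: lowest_brick_def cInf_lower)

lemma lowest_row_subset: "lowest_row K \<eta> \<subseteq> {..<K}"
  by (auto simp: lowest_row_def present_def cells_def)

lemma finite_lowest_row: "finite (lowest_row K \<eta>)"
  using lowest_row_subset finite_subset by blast

lemma lowest_row_nonempty: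
  assumes "1 \<le> K" "well_filled K \<eta>"
  shows "lowest_row K \<eta> \<noteq> {}"
proof -
  have "infinite (cells K)"
    using assms(1) by (auto simp: cells_def finite_cartesian_product_iff lessThan_empty_iff)
  then have "present K \<eta> \<noteq> {}"
    using assms(2) by (auto simp: well_filled_def missing_eq)
  then have "lowest_brick K \<eta> \<in> snd ` present K \<eta>"
    unfolding lowest_brick_def by (intro Inf_nat_def1) auto
  then show ?thesis by (auto simp: lowest_row_def)
qed

lemma free_width_bounds:
  assumes "1 \<le> K" "well_filled K \<eta>"
  shows "0 \<le> free_width K \<eta>" "free_width K \<eta> \<le> real K - 1"
    and "0 \<le> free_width K \<eta> * (free_width K \<eta> - 1)"
proof -
  have "card (lowest_row K \<eta>) \<le> K"
    using card_mono[OF _ lowest_row_subset] by fastforce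
  then obtain n where n: "free_width K \<eta> = real n"
    unfolding free_width_def by (metis of_nat_diff)
  then show "0 \<le> free_width K \<eta>" by simp
  have "0 < card (lowest_row K \<eta>)"
    using lowest_row_nonempty[OF assms] finite_lowest_row by (simp add: card_gt_0_iff)
  then show "free_width K \<eta> \<le> real K - 1" by (simp add: free_width_def)
  show "0 \<le> free_width K \<eta> * (free_width K \<eta> - 1)"
    by (cases n) (auto simp: n)
qed

lemma lowest_brick_mono:
  assumes "1 \<le> K" "well_filled K \<eta>'" "present K \<eta>' \<subseteq> present K \<eta>"
  shows "lowest_brick K \<eta> \<le> lowest_brick K \<eta>'"
proof -
  obtain i where "(i, lowest_brick K \<eta>') \<in> present K \<eta>'"
    using lowest_row_nonempty[OF assms(1,2)] by (auto simp: lowest_row_def)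
  then show ?thesis using assms(3) lowest_brick_le by fastforce
qed

lemma remove_brick:
  assumes "well_filled K \<eta>" "z \<in> present K \<eta>" "present K \<eta>' = present K \<eta> - {z}"
  shows "missing K \<eta>' = insert z (missing K \<eta>)" "z \<notin> missing K \<eta>" "well_filled K \<eta>'"
proof -
  show *: "missing K \<eta>' = insert z (missing K \<eta>)"
    using assms(2,3) present_subset_cells[of K \<eta>] by (auto simp: missing_eq)
  show "z \<notin> missing K \<eta>" using assms(2) by (simp add: missing_eq)
  show "well_filled K \<eta>'" using assms(1) * by (simp add: well_filled_def)
qed

lemma free_width_remove:
  assumes i: "i \<in> lowest_row K \<eta>"
    and rem: "present K \<eta>' = present K \<eta> - {(i, lowest_brick K \<eta>)}"
    and same: "lowest_brick K \<eta>' = lowest_brick K \<eta>"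
  shows "free_width K \<eta>' = free_width K \<eta> + 1"
proof -
  have "lowest_row K \<eta>' = lowest_row K \<eta> - {i}"
    by (auto simp: lowest_row_def rem same)
  moreover have "0 < card (lowest_row K \<eta>)"
    using i finite_lowest_row by (auto simp: card_gt_0_iff)
  ultimately show ?thesis
    using i finite_lowest_row by (simp add: free_width_def card_Diff_singleton of_nat_diff)
qed

section \<open>Shallow shots: a single flight\<close>

text \<open>
  The constants \<open>c\<close> and \<open>s\<close> are the cosine and sine of the initial angle. Bounces only change
  the signs of the velocity components, so the ball always moves along lines of slope
  \<open>s / c\<close> up to sign, and \<open>shallow\<close> is the condition \<open>tan \<theta>0 < 1 / (K (K - 1))\<close>, written so that
  it says nothing beyond \<open>0 < c\<close> for \<open>K = 1\<close>.
\<close>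
locale shallow_shot =
  fixes K :: nat and h c s :: real
  assumes K: "1 \<le> K" and h: "0 \<le> h"
    and c: "0 < c" "c \<le> 1" and s: "0 < s" "s \<le> 1"
    and shallow: "s * (real K * (real K - 1)) < c"
begin

lemma slope_bound:
  assumes "0 \<le> w" "w \<le> real K - 1"
  shows "s / c * (w * (w + 1)) < 1"
proof -
  have "w * (w + 1) \<le> (real K - 1) * real K"
    using assms by (intro mult_mono) auto
  then have "s * (w * (w + 1)) \<le> s * (real K * (real K - 1))"
    using s by (simp add: mult.commute)
  then show ?thesis using shallow c by (simp add: field_simps)
qed

text \<open>
  The invariant of the motion, with \<open>H\<close> the lowest nonempty row and \<open>w\<close> the total width of its
  missing bricks. A falling ball is below row \<open>H\<close>. A rising one that has already entered the row is
  bounded by a budget of horizontal distance. With missing width \<open>v\<close>, the ball crosses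
  at most \<open>2 * v\<close> before it destroys the next side brick: at most \<open>v\<close> to a wall, and \<open>v\<close> back, since the
  remaining bricks of the row bar the way to the opposite wall. So the distance spent inside
  the row until missing width \<open>w\<close> is reached is at most \<open>2 * (1 + \<dots> + (w - 1)) = w * (w - 1)\<close>, and
  a wall hit may add \<open>w\<close> to this, which gives \<open>w\<^sup>2\<close>.
\<close>
definition confined :: "state \<Rightarrow> bool" where
  "confined S \<longleftrightarrow> admissible K h S \<and>
     (case S of ((x, y), \<eta>, \<theta>) \<Rightarrow>
        \<bar>cos \<theta>\<bar> = c \<and> \<bar>sin \<theta>\<bar> = s \<and>
        (let H = real (lowest_brick K \<eta>); w = free_width K \<eta>
         in sin \<theta> < 0 \<and> y \<le> H \<or>
            0 < sin \<theta> \<and> (y \<le> H + s / c * (w * (w - 1)) \<or>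
                         y \<le> H + s / c * w\<^sup>2 \<and> (x = 0 \<or> x = real K))))"

end

text \<open>
  One flight, from the state \<open>((x, y), \<eta>, \<theta>)\<close> up to the next bounce. Primed names refer to the
  moment just after that bounce.
\<close>
locale flight = shallow_shot +
  fixes x y :: real and \<eta> :: config and \<theta> :: real
  assumes conf: "confined ((x, y), \<eta>, \<theta>)"
    and nv: "\<not> hits_vertex K h ((x, y), \<eta>, \<theta>)"
begin

definition \<tau> :: real where "\<tau> = hit_time K h ((x, y), \<eta>, \<theta>)"
definition x' :: real where "x' = x + \<tau> * cos \<theta>"
definition y' :: real where "y' = y + \<tau> * sin \<theta>"
definition \<eta>' :: config where "\<eta>' = (\<lambda>z. \<eta> z \<and> (x', y') \<notin> brick z)"
abbreviation H :: nat where "H \<equiv> lowest_brick K \<eta>"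
abbreviation w :: real where "w \<equiv> free_width K \<eta>"

lemma adm: "admissible K h ((x, y), \<eta>, \<theta>)"
  and abs_cos: "\<bar>cos \<theta>\<bar> = c" and abs_sin: "\<bar>sin \<theta>\<bar> = s"
  using conf by (auto simp: confined_def)

lemma down_start: "sin \<theta> < 0 \<Longrightarrow> y \<le> real H"
  using conf by (auto simp: confined_def Let_def)

lemma up_start:
  "0 < sin \<theta> \<Longrightarrow> y \<le> real H + s / c * (w * (w - 1)) \<or>
     y \<le> real H + s / c * w\<^sup>2 \<and> (x = 0 \<or> x = real K)"
  using conf by (auto simp: confined_def Let_def)

lemma cos_cases: "cos \<theta> = c \<or> cos \<theta> = - c" and sin_cases: "sin \<theta> = s \<or> sin \<theta> = - s"
  and cos_nonzero: "cos \<theta> \<noteq> 0" and sin_nonzero: "sin \<theta> \<noteq> 0"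
  using abs_cos abs_sin c s by linarith+

lemma wf: "well_filled K \<eta>" and start_strip: "0 \<le> x" "x \<le> real K" "- h \<le> y"
  using adm table_subset_strip[of K h \<eta>] by (auto simp: strip_def)

lemmas w_bounds = free_width_bounds[OF K wf]

lemma \<tau>_pos: "0 < \<tau>"
  using first_hit(1)[OF adm cos_nonzero] by (simp add: \<tau>_def)

lemma path:
  assumes "0 < r" "r < \<tau>"
  shows "0 < x + r * cos \<theta>" "x + r * cos \<theta> < real K" "- h < y + r * sin \<theta>"
    and "(x + r * cos \<theta>, y + r * sin \<theta>) \<notin> bricks K \<eta>"
  using first_hit(2)[OF adm cos_nonzero, of r] assms
  by (auto simp: \<tau>_def interior_table velocity_def)

lemma hit_point: "hit_point K h ((x, y), \<eta>, \<theta>) = (x', y')"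
  by (simp add: x'_def y'_def \<tau>_def velocity_def)

lemma end_frontier: "(x', y') \<in> frontier (table K h \<eta>)"
  using first_hit(3)[OF adm cos_nonzero] by (simp add: x'_def y'_def \<tau>_def velocity_def)

lemma end_strip: "0 \<le> x'" "x' \<le> real K" "- h \<le> y'"
  and end_boundary: "x' = 0 \<or> x' = real K \<or> y' = - h \<or> (x', y') \<in> bricks K \<eta>"
  using frontier_tableD[OF end_frontier] by (auto simp: strip_def)

lemma end_no_vertex:
  "(x', y') \<notin> strip_vertices K h" "z \<in> present K \<eta> \<Longrightarrow> (x', y') \<notin> brick_vertices z"
  using nv hit_point by (auto simp del: hit_point.simps)

lemma present': "present K \<eta>' = {z \<in> present K \<eta>. (x', y') \<notin> brick z}"
  by (auto simp: present_def \<eta>'_def)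

lemma bounce:
  "bounce K h ((x, y), \<eta>, \<theta>) =
     ((x', y'), \<eta>', if on_horizontal_side K h \<eta> (x', y') then - \<theta> else pi - \<theta>)"
  using hit_point by (simp add: Let_def \<eta>'_def del: hit_point.simps)

lemma end_x:
  "0 < cos \<theta> \<Longrightarrow> 0 < x'" "cos \<theta> < 0 \<Longrightarrow> x' < real K"
  "x' = 0 \<Longrightarrow> cos \<theta> < 0" "x' = real K \<Longrightarrow> 0 < cos \<theta>"
proof -
  have m: "0 < x + \<tau>/2 * cos \<theta>" "x + \<tau>/2 * cos \<theta> < real K"
    using path[of "\<tau>/2"] \<tau>_pos by auto
  have e: "x' = (x + \<tau>/2 * cos \<theta>) + \<tau>/2 * cos \<theta>"
    by (simp add: x'_def)
  have "0 < \<tau>/2 * cos \<theta>" if "0 < cos \<theta>" using that \<tau>_pos by simp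
  moreover have "\<tau>/2 * cos \<theta> < 0" if "cos \<theta> < 0" using that \<tau>_pos by (simp add: mult_pos_neg)
  moreover have "cos \<theta> < 0 \<or> 0 < cos \<theta>" using cos_nonzero by linarith
  ultimately show "0 < cos \<theta> \<Longrightarrow> 0 < x'" "cos \<theta> < 0 \<Longrightarrow> x' < real K"
    "x' = 0 \<Longrightarrow> cos \<theta> < 0" "x' = real K \<Longrightarrow> 0 < cos \<theta>"
    using m e by linarith+
qed

lemma end_y: "0 < sin \<theta> \<Longrightarrow> y < y'" "sin \<theta> < 0 \<Longrightarrow> y' < y"
  using \<tau>_pos by (simp_all add: y'_def mult_pos_neg)

text \<open>
  The path of the flight avoids the bricks of the lowest row, so what it covers horizontally
  at the height of that row fits into the missing part of the row.
\<close>
lemma row_travel: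
  assumes up: "0 < sin \<theta>" and r: "0 \<le> r1" "r1 < r2" "r2 \<le> \<tau>"
    and y: "real H \<le> y + r1 * sin \<theta>" "y + r2 * sin \<theta> \<le> real H + 1"
  shows "c * (r2 - r1) \<le> w"
proof -
  define a where "a = min (x + r1 * cos \<theta>) (x + r2 * cos \<theta>)"
  define b where "b = max (x + r1 * cos \<theta>) (x + r2 * cos \<theta>)"
  have len: "b - a = c * (r2 - r1)"
    using cos_cases r(2) c by (auto simp: a_def b_def min_def max_def algebra_simps)
  have between: "0 \<le> x + t * cos \<theta> \<and> x + t * cos \<theta> \<le> real K" if "0 \<le> t" "t \<le> \<tau>" for t
  proof -
    consider "t = 0" | "t = \<tau>" | "0 < t" "t < \<tau>" using \<open>0 \<le> t\<close> \<open>t \<le> \<tau>\<close> by linarith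
    then show ?thesis
    proof cases
      case 1 then show ?thesis using start_strip by simp
    next
      case 2 then show ?thesis using end_strip by (simp add: x'_def)
    next
      case 3 then show ?thesis using path[of t] by simp
    qed
  qed
  have "b - a \<le> real K - real (card (lowest_row K \<eta>))"
  proof (rule free_interval_length[OF lowest_row_subset])
    show "0 \<le> a" "a \<le> b" "b \<le> real K"
      using between[of r1] between[of r2] r by (auto simp: a_def b_def)
    fix i assume i: "i \<in> lowest_row K \<eta>"
    show "real i + 1 \<le> a \<or> b \<le> real i"
    proof (rule ccontr)
      assume "\<not> ?thesis"
      moreover have "a < b" using len c r(2) by (metis diff_gt_0_iff_gt mult_pos_pos)
      ultimately have "max a (real i) < min b (real i + 1)" by auto
      then obtain u where u: "max a (real i) < u" "u < min b (real i + 1)"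
        using dense by blast
      define t where "t = (u - x) / cos \<theta>"
      have ut: "u = x + t * cos \<theta>" using cos_nonzero by (simp add: t_def)
      have "r1 < t \<and> t < r2"
      proof (cases "0 < cos \<theta>")
        case True
        then have "r1 * cos \<theta> \<le> r2 * cos \<theta>" using r(2) by simp
        then have "r1 * cos \<theta> < t * cos \<theta>" "t * cos \<theta> < r2 * cos \<theta>"
          using u by (auto simp: ut a_def b_def)
        then show ?thesis using True by simp
      next
        case False
        then have neg: "cos \<theta> < 0" using cos_nonzero by simp
        then have "r2 * cos \<theta> \<le> r1 * cos \<theta>" using r(2) by simp
        then have "r2 * cos \<theta> < t * cos \<theta>" "t * cos \<theta> < r1 * cos \<theta>"
          using u by (auto simp: ut a_def b_def)
        then show ?thesis using neg by (simp add: mult_less_cancel_right)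
      qed
      moreover from this have "r1 * sin \<theta> \<le> t * sin \<theta>" "t * sin \<theta> \<le> r2 * sin \<theta>"
        using up by simp_all
      moreover have "(i, H) \<in> present K \<eta>" using i by (simp add: lowest_row_def)
      ultimately show False
        using path(4)[of t] r y u by (force simp: ut[symmetric] mem_brick)
    qed
  qed
  then show ?thesis by (simp add: len free_width_def)
qed

text \<open>
  Once in the lowest row the ball gains height \<open>s / c\<close> per unit of horizontal distance, and it has
  at most \<open>w\<close> units available. A ball that rose higher would violate this at an earlier height \<open>Y\<close>
  that still lies inside the row.
\<close>
lemma climb:
  assumes up: "0 < sin \<theta>" and room: "max (real H) y + s / c * w < real H + 1"
  shows "y' \<le> max (real H) y + s / c * w"
proof (rule ccontr)
  assume "\<not> ?thesis"
  then have "max (real H) y + s / c * w < min y' (real H + 1)" using room by simp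
  then obtain Y where Y: "max (real H) y + s / c * w < Y" "Y < y'" "Y < real H + 1"
    using dense[of "max (real H) y + s / c * w" "min y' (real H + 1)"] by auto
  have sin: "sin \<theta> = s" using up sin_cases s by auto
  \<comment> \<open>The times at which the ball is in the row for the first time and at which it reaches height \<open>Y\<close>.\<close>
  define r1 where "r1 = (max (real H) y - y) / s"
  define r2 where "r2 = (Y - y) / s"
  have r1: "y + r1 * s = max (real H) y" and r2: "y + r2 * s = Y"
    using s by (simp_all add: r1_def r2_def)
  have "0 \<le> s / c * w" using s c w_bounds by simp
  then have "r1 * s < r2 * s" using r1 r2 Y(1) by linarith
  then have "r1 < r2" using s by simp
  moreover have "0 \<le> r1" using s by (simp add: r1_def)
  moreover have "r2 * s < \<tau> * s" using Y(2) r2 by (simp add: y'_def sin)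
  then have "r2 \<le> \<tau>" using s by simp
  ultimately have "c * (r2 - r1) \<le> w"
    using row_travel[OF up, of r1 r2] Y r1 r2 by (simp add: sin)
  then have "s / c * (c * (r2 - r1)) \<le> s / c * w"
    using s c by (intro mult_left_mono) auto
  moreover have "s / c * (c * (r2 - r1)) = Y - max (real H) y"
    using c r1 r2 by (simp add: algebra_simps)
  ultimately show False using Y(1) by linarith
qed

text \<open>
  The budget is respected: a flight adds at most \<open>w\<close> to the distance spent, and as at least
  one brick of the row remains, \<open>w * (w + 1) \<le> (K - 1) * K\<close> keeps the ball strictly below the
  next row. This is where the threshold angle comes from. A flight inside the row that starts
  at one wall cannot end at the other, so two wall hits never occur in a row at that height.
\<close>
lemma end_up:
  assumes up: "0 < sin \<theta>"
  shows "y' \<le> real H + s / c * (w * (w + 1))" "y' < real H + 1"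
    and "x' = 0 \<or> x' = real K \<Longrightarrow> y' \<le> real H + s / c * w\<^sup>2"
proof -
  have k: "0 < s / c" using s c by simp
  have small: "s / c * (w * (w + 1)) < 1"
    using slope_bound w_bounds by blast
  have le1: "s / c * (w * (w - 1)) + s / c * w = s / c * w\<^sup>2"
    by (simp add: power2_eq_square algebra_simps)
  have le2: "s / c * w\<^sup>2 + s / c * w = s / c * (w * (w + 1))"
    by (simp add: power2_eq_square algebra_simps)
  have nn: "0 \<le> s / c * w" "0 \<le> s / c * w\<^sup>2" "0 \<le> s / c * (w * (w - 1))"
    using k w_bounds by (auto simp del: times_divide_eq_left intro!: mult_nonneg_nonneg)
  consider (fresh) "y \<le> real H + s / c * (w * (w - 1))"
    | (wall) "real H + s / c * (w * (w - 1)) < y" "y \<le> real H + s / c * w\<^sup>2" "x = 0 \<or> x = real K"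
    using up_start[OF up] by linarith
  then have *: "y' \<le> real H + s / c * (w * (w + 1)) \<and>
    (x' = 0 \<or> x' = real K \<longrightarrow> y' \<le> real H + s / c * w\<^sup>2)"
  proof cases
    case fresh
    then have "max (real H) y + s / c * w \<le> real H + s / c * w\<^sup>2" using le1 nn by simp
    then have "y' \<le> real H + s / c * w\<^sup>2"
      using climb[OF up] le2 nn small by linarith
    then show ?thesis using le2 nn by linarith
  next
    case wall
    then have m: "max (real H) y + s / c * w \<le> real H + s / c * (w * (w + 1))"
      using le2 nn by simp
    then have y': "y' \<le> real H + s / c * (w * (w + 1))"
      using climb[OF up] small by linarith
    have "\<not> (x' = 0 \<or> x' = real K)"
    proof
      assume e: "x' = 0 \<or> x' = real K"
      have "c * (\<tau> - 0) \<le> w"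
        using wall(1) nn y' small \<tau>_pos by (intro row_travel up) (auto simp: y'_def)
      moreover have "c * \<tau> = real K"
      proof -
        have "0 < c * \<tau>" using c \<tau>_pos by simp
        moreover have "x' = x + c * \<tau> \<or> x' = x - c * \<tau>"
          using cos_cases by (auto simp: x'_def mult.commute)
        ultimately show ?thesis using e wall(3) end_strip by linarith
      qed
      ultimately show False using w_bounds(2) by simp
    qed
    then show ?thesis using y' by blast
  qed
  then show "y' \<le> real H + s / c * (w * (w + 1))"
    and "x' = 0 \<or> x' = real K \<Longrightarrow> y' \<le> real H + s / c * w\<^sup>2" by auto
  then show "y' < real H + 1" using small by linarith
qed

lemma end_below: "y' < real H + 1"
  using end_up(2) end_y(2) down_start sin_nonzero by (cases "0 < sin \<theta>") force+

lemma hit_brick_row: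
  assumes "(i, j) \<in> present K \<eta>" "(x', y') \<in> brick (i, j)"
  shows "j = H" "0 < sin \<theta>"
proof -
  have "H \<le> j" using lowest_brick_le[OF assms(1)] by simp
  moreover have "real j \<le> y'" using assms(2) by (simp add: mem_brick)
  ultimately show "j = H" using end_below by linarith
  have "\<not> sin \<theta> < 0"
    using end_y(2) down_start \<open>H \<le> j\<close> \<open>real j \<le> y'\<close> by linarith
  then show "0 < sin \<theta>" using sin_nonzero by simp
qed

lemma hit_brick_bottom:
  assumes "(i, H) \<in> present K \<eta>" "(x', y') \<in> brick (i, H)" "y' = real H"
  shows "real i < x'" "x' < real i + 1"
  using end_no_vertex(2)[OF assms(1)] assms(2,3)
  by (auto simp: brick_vertices_def mem_brick less_le)

text \<open>
  Within the row the ball can only meet a brick on the side facing it, since otherwise it would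
  have been inside the brick shortly before.
\<close>
lemma hit_brick_side:
  assumes z: "(i, H) \<in> present K \<eta>" "(x', y') \<in> brick (i, H)" and above: "real H < y'"
  shows "x' = (if 0 < cos \<theta> then real i else real i + 1)"
proof (rule ccontr)
  assume ne: "\<not> ?thesis"
  have up: "0 < sin \<theta>" using hit_brick_row[OF z] by simp
  have sin: "sin \<theta> = s" using up sin_cases s by auto
  have b: "real i \<le> x'" "x' \<le> real i + 1" using z(2) by (auto simp: mem_brick)
  \<comment> \<open>Going back by less than \<open>d\<close> keeps the ball in the column and in the row of the brick.\<close>
  define d where "d = min (if 0 < cos \<theta> then x' - real i else real i + 1 - x') (y' - real H)"
  have "0 < d" using ne b above by (auto simp: d_def)
  define e where "e = min (\<tau> / 2) (d / 2)"
  have e: "0 < e" "e < \<tau>" "e < d" using \<open>0 < d\<close> \<tau>_pos by (auto simp: e_def)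
  have ec: "e * c \<le> e" "e * s \<le> e" using e c s by (auto intro: mult_left_le)
  have pos: "0 < e * c" "0 < e * s" using e c s by auto
  have X: "x + (\<tau> - e) * cos \<theta> = x' - e * cos \<theta>" and Y: "y + (\<tau> - e) * sin \<theta> = y' - e * s"
    by (simp_all add: x'_def y'_def sin algebra_simps)
  have "real H \<le> y' - e * s" "y' - e * s \<le> real H + 1"
    using e ec pos end_below by (auto simp: d_def)
  moreover have "real i \<le> x' - e * cos \<theta> \<and> x' - e * cos \<theta> \<le> real i + 1"
  proof (cases "0 < cos \<theta>")
    case True
    then have "e * cos \<theta> = e * c" "e < x' - real i" using cos_cases c e by (auto simp: d_def)
    then show ?thesis using ec pos b by linarith
  next
    case False
    then have "e * cos \<theta> = - (e * c)" "e < real i + 1 - x'"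
      using cos_cases c e by (auto simp: d_def)
    then show ?thesis using ec pos b by linarith
  qed
  ultimately have "(x + (\<tau> - e) * cos \<theta>, y + (\<tau> - e) * sin \<theta>) \<in> brick (i, H)"
    by (simp add: X Y mem_brick)
  then show False using path(4)[of "\<tau> - e"] e z(1) by auto
qed

lemma horizontal_side_hit:
  assumes "(i, H) \<in> present K \<eta>" "(x', y') \<in> brick (i, H)"
  shows "on_horizontal_side K h \<eta> (x', y') \<longleftrightarrow> y' = real H"
proof
  assume "on_horizontal_side K h \<eta> (x', y')"
  moreover have "y' \<noteq> - h"
    using end_y(1) start_strip(3) hit_brick_row[OF assms] by simp
  ultimately obtain i' j' where z: "(i', j') \<in> present K \<eta>" "(x', y') \<in> brick (i', j')"
    and "y' = real j' \<or> y' = real j' + 1"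
    by (auto simp: on_horizontal_side_def)
  then show "y' = real H" using hit_brick_row(1)[OF z] end_below by auto
next
  assume "y' = real H"
  then show "on_horizontal_side K h \<eta> (x', y')"
    using assms by (force simp: on_horizontal_side_def)
qed

text \<open>
  Two bricks of a row that share the hit point also share a vertical side there. The ball would hit
  it either at a vertex, which is excluded, or after having passed through one of the two.
\<close>
lemma unique_brick:
  assumes z: "(i, H) \<in> present K \<eta>" "(x', y') \<in> brick (i, H)"
  shows "present K \<eta>' = present K \<eta> - {(i, H)}"
proof -
  have "i' = i \<and> j' = H" if z': "(i', j') \<in> present K \<eta>" "(x', y') \<in> brick (i', j')" for i' j'
  proof -
    have j': "j' = H" using hit_brick_row(1)[OF z'] .
    have "real H \<le> y'" using z(2) by (simp add: mem_brick)
    then consider "y' = real H" | "real H < y'" by linarith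
    then have "i' = i"
    proof cases
      case 1
      then show ?thesis
        using hit_brick_bottom[OF z] hit_brick_bottom[of i'] z' j' by force
    next
      case 2
      then have "x' = (if 0 < cos \<theta> then real i else real i + 1)"
        and "x' = (if 0 < cos \<theta> then real i' else real i' + 1)"
        using hit_brick_side[OF z 2] hit_brick_side[OF z'[unfolded j'] 2] by simp_all
      then have "real i = real i'" by (metis add_right_cancel)
      then show ?thesis by simp
    qed
    then show ?thesis using j' by simp
  qed
  then have "z = (i, H)" if "z \<in> present K \<eta>" "(x', y') \<in> brick z" for z
    using that by (cases z) blast
  then show ?thesis unfolding present' using z by blast
qed

lemma bounce_cases:
  obtains
    (floor) "bounce K h ((x, y), \<eta>, \<theta>) = ((x', y'), \<eta>', - \<theta>)" "present K \<eta>' = present K \<eta>"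
      "sin \<theta> < 0" "y' = - h" "0 < x'" "x' < real K"
  | (wall) "bounce K h ((x, y), \<eta>, \<theta>) = ((x', y'), \<eta>', pi - \<theta>)" "present K \<eta>' = present K \<eta>"
      "x' = (if 0 < cos \<theta> then real K else 0)" "- h < y'"
  | (bottom) i where "bounce K h ((x, y), \<eta>, \<theta>) = ((x', y'), \<eta>', - \<theta>)"
      "i \<in> lowest_row K \<eta>" "present K \<eta>' = present K \<eta> - {(i, H)}"
      "0 < sin \<theta>" "y' = real H" "real i < x'" "x' < real i + 1"
  | (side) i where "bounce K h ((x, y), \<eta>, \<theta>) = ((x', y'), \<eta>', pi - \<theta>)"
      "i \<in> lowest_row K \<eta>" "present K \<eta>' = present K \<eta> - {(i, H)}"
      "0 < sin \<theta>" "real H < y'"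
proof (cases "(x', y') \<in> bricks K \<eta>")
  case True
  then obtain i j where z: "(i, j) \<in> present K \<eta>" "(x', y') \<in> brick (i, j)" by auto
  have j: "j = H" and up: "0 < sin \<theta>" using hit_brick_row[OF z] by auto
  have i: "i \<in> lowest_row K \<eta>" using z(1) j by (simp add: lowest_row_def)
  note z = z[unfolded j]
  have "real H \<le> y'" using z(2) by (simp add: mem_brick)
  then consider "y' = real H" | "real H < y'" by linarith
  then show thesis
  proof cases
    case 1
    then show thesis
      using bottom[OF _ i unique_brick[OF z] up] bounce horizontal_side_hit[OF z]
        hit_brick_bottom[OF z] by (simp del: bounce.simps)
  next
    case 2
    then show thesis
      using side[OF _ i unique_brick[OF z] up] bounce horizontal_side_hit[OF z]
      by (simp del: bounce.simps)
  qed
next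
  case False
  then have same: "present K \<eta>' = present K \<eta>" by (auto simp: present')
  have hor: "on_horizontal_side K h \<eta> (x', y') \<longleftrightarrow> y' = - h"
    using False by (auto simp: on_horizontal_side_def)
  show thesis
  proof (cases "y' = - h")
    case True
    then have "x' \<noteq> 0" "x' \<noteq> real K"
      using end_no_vertex(1) by (auto simp: strip_vertices_def)
    moreover have "\<not> 0 < sin \<theta>" using end_y(1) start_strip(3) True by linarith
    then have "sin \<theta> < 0" using sin_nonzero by linarith
    ultimately show thesis
      using floor[OF _ same] bounce hor True end_strip by (simp del: bounce.simps)
  next
    case ne: False
    then have "x' = 0 \<or> x' = real K" using end_boundary False by blast
    then have "x' = (if 0 < cos \<theta> then real K else 0)" using end_x by auto
    then show thesis
      using wall[OF _ same] bounce hor ne end_strip by (simp del: bounce.simps)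
  qed
qed

end

section \<open>The invariant persists\<close>

context shallow_shot
begin

lemma confined_below:
  assumes "admissible K h ((x, y), \<eta>, \<theta>)" "\<bar>cos \<theta>\<bar> = c" "\<bar>sin \<theta>\<bar> = s"
    and "y \<le> real (lowest_brick K \<eta>)"
  shows "confined ((x, y), \<eta>, \<theta>)"
proof -
  have "0 \<le> s / c * (free_width K \<eta> * (free_width K \<eta> - 1))"
    using s c free_width_bounds(3)[OF K] assms(1) by (simp del: times_divide_eq_left)
  then show ?thesis using assms s by (auto simp: confined_def Let_def)
qed

end

context flight
begin

lemma end_off_bricks: "(x', y') \<notin> bricks K \<eta>'"
  by (auto simp: present')

lemma present'_subset: "present K \<eta>' \<subseteq> present K \<eta>"
  by (auto simp: present')

lemma wf': "well_filled K \<eta>'"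
proof (cases rule: bounce_cases)
  case floor then show ?thesis using wf by (simp add: well_filled_def missing_eq)
next
  case wall then show ?thesis using wf by (simp add: well_filled_def missing_eq)
next
  case (bottom i) then show ?thesis
    using remove_brick(3)[OF wf] by (simp add: lowest_row_def)
next
  case (side i) then show ?thesis
    using remove_brick(3)[OF wf] by (simp add: lowest_row_def)
qed

lemma lowest_mono: "H \<le> lowest_brick K \<eta>'"
  by (intro lowest_brick_mono K wf' present'_subset)

lemma admissible_bounce: "admissible K h (bounce K h ((x, y), \<eta>, \<theta>))"
proof -
  have "(x', y') \<in> strip K h" using end_strip by (simp add: strip_def)
  note adm' = inward_admissible[OF K wf' this end_off_bricks]
  show ?thesis
  proof (cases rule: bounce_cases)
    case floor
    then have "0 < sin (- \<theta>)" by simp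
    then show ?thesis unfolding floor(1) using floor(5,6) by (intro adm') auto
  next
    case wall
    then show ?thesis unfolding wall(1) using end_x(1,2) cos_nonzero by (intro adm') auto
  next
    case (bottom i)
    then have "real i + 1 \<le> real K" using lowest_row_subset[of K \<eta>] by auto
    then have "0 < x'" "x' < real K" "- h < y'"
      using bottom end_y(1) start_strip by auto
    then show ?thesis unfolding bottom(1) by (intro adm') auto
  next
    case (side i)
    then have "- h < y'" using end_y(1) start_strip by auto
    then show ?thesis unfolding side(1) using end_x(1,2) cos_nonzero by (intro adm') auto
  qed
qed

text \<open>
  The budget survives each kind of bounce. Removing a side brick turns \<open>w\<close> into \<open>w + 1\<close> and the
  spent distance \<open>w * (w + 1)\<close> into exactly the allowance after a removal. If the row has just been
  emptied, the ball is below the new lowest row and the budget starts afresh.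
\<close>
lemma confined_bounce: "confined (bounce K h ((x, y), \<eta>, \<theta>))"
proof (cases rule: bounce_cases)
  case floor
  have "y' \<le> real (lowest_brick K \<eta>')" using floor(4) h by simp
  moreover have "admissible K h ((x', y'), \<eta>', - \<theta>)" using admissible_bounce floor(1) by simp
  ultimately show ?thesis
    unfolding floor(1) using abs_cos abs_sin by (intro confined_below) auto
next
  case wall
  have same: "lowest_brick K \<eta>' = H" "free_width K \<eta>' = w"
    using wall(2) by (simp_all add: lowest_brick_def free_width_def lowest_row_def)
  have adm': "admissible K h ((x', y'), \<eta>', pi - \<theta>)" using admissible_bounce wall(1) by simp
  show ?thesis
  proof (cases "0 < sin \<theta>")
    case True
    have "x' = 0 \<or> x' = real K" using wall(3) by simp
    then have "y' \<le> real H + s / c * w\<^sup>2" "x' = 0 \<or> x' = real K" using end_up(3)[OF True] by auto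
    then show ?thesis
      using True adm' abs_cos abs_sin unfolding wall(1)
      by (auto simp: confined_def Let_def same simp del: admissible.simps)
  next
    case False
    then have "y' \<le> real (lowest_brick K \<eta>')"
      using end_y(2) down_start sin_nonzero same by force
    then show ?thesis
      using adm' abs_cos abs_sin unfolding wall(1) by (intro confined_below) auto
  qed
next
  case (bottom i)
  have "y' \<le> real (lowest_brick K \<eta>')" using bottom(5) lowest_mono by simp
  moreover have "admissible K h ((x', y'), \<eta>', - \<theta>)" using admissible_bounce bottom(1) by simp
  ultimately show ?thesis
    unfolding bottom(1) using abs_cos abs_sin by (intro confined_below) auto
next
  case (side i)
  have adm': "admissible K h ((x', y'), \<eta>', pi - \<theta>)" using admissible_bounce side(1) by simp
  show ?thesis
  proof (cases "lowest_brick K \<eta>' = H")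
    case True
    have "free_width K \<eta>' = w + 1" by (rule free_width_remove[OF side(2,3) True])
    then have "y' \<le> real H + s / c * (free_width K \<eta>' * (free_width K \<eta>' - 1))"
      using end_up(1)[OF side(4)] by (simp add: mult.commute)
    then show ?thesis
      using side(4) adm' abs_cos abs_sin unfolding side(1)
      by (auto simp: confined_def Let_def True simp del: admissible.simps)
  next
    case False
    then have "y' \<le> real (lowest_brick K \<eta>')" using lowest_mono end_below by linarith
    then show ?thesis
      using adm' abs_cos abs_sin unfolding side(1) by (intro confined_below) auto
  qed
qed

lemma card_missing':
  "card (missing K \<eta>') = (if present K \<eta>' = present K \<eta> then card (missing K \<eta>) else card (missing K \<eta>) + 1)"
proof (cases "present K \<eta>' = present K \<eta>")
  case True then show ?thesis by (simp add: missing_eq)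
next
  case False
  then obtain z where "z \<in> present K \<eta>" "present K \<eta>' = present K \<eta> - {z}"
    by (cases rule: bounce_cases) (auto simp: lowest_row_def)
  then show ?thesis
    using False remove_brick[OF wf] wf by (simp add: well_filled_def)
qed

text \<open>
  The bound \<open>H \<le> y'\<close> records that bricks are destroyed at the height of the ball, hence not above
  what the elapsed time permits.
\<close>
lemma missing'_subset:
  "missing K \<eta>' \<subseteq> missing K \<eta> \<union> {z \<in> cells K. snd z = H \<and> real H \<le> y'}"
proof -
  have "z \<in> missing K \<eta> \<or> snd z = H \<and> real H \<le> y'" if z: "z \<in> missing K \<eta>'" for z
  proof (cases "z \<in> missing K \<eta>")
    case False
    then have *: "z \<in> present K \<eta>" "(x', y') \<in> brick z"
      using z by (auto simp: missing_eq present')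
    obtain i j where "z = (i, j)" by fastforce
    then show ?thesis using * hit_brick_row(1)[of i j] by (auto simp: mem_brick)
  qed simp
  then show ?thesis by (auto simp: missing_eq)
qed

end

section \<open>Gauges for the number of bounces and for the elapsed time\<close>

context shallow_shot
begin

text \<open>
  Reflecting the strip turns the horizontal motion into one at constant speed \<open>c\<close>, in which
  \<open>sgn (cos \<theta>) * (x - K / 2)\<close> runs from \<open>- K / 2\<close> to \<open>K / 2\<close> and is reset at every wall hit, which
  pays \<open>K\<close>. Floor hits are paid for by the flag for an upward velocity, brick hits by the count of missing
  bricks, whose weight also covers the loss in the other two terms. So every bounce
  raises \<open>bounce_gauge + c * time\<close> by at least \<open>K\<close>, which bounds the number of bounces per time.
\<close>
fun bounce_gauge :: "state \<Rightarrow> real" where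
  "bounce_gauge ((x, y), \<eta>, \<theta>) =
     real K * of_bool (0 < sin \<theta>) - sgn (cos \<theta>) * (x - real K / 2)
     + 2 * real K * real (card (missing K \<eta>))"

text \<open>
  In the same spirit for the vertical motion: the signed height above the floor grows at constant
  speed \<open>s\<close>, passes continuously through the floor, and drops by twice the height of row \<open>H\<close> above the
  floor when the bottom of a brick is hit. As long as \<open>H \<le> m\<close>, the missing brick pays for that drop.
  A gauge that is bounded while only rows below \<open>m\<close> are being cleared bounds the time this takes.
\<close>
fun rise_gauge :: "real \<Rightarrow> state \<Rightarrow> real" where
  "rise_gauge m ((x, y), \<eta>, \<theta>) = sgn (sin \<theta>) * (y + h) + 2 * (m + h) * real (card (missing K \<eta>))"

end

context flight
begin

lemma unfolded_x: "sgn (cos \<theta>) * (x' - a) = sgn (cos \<theta>) * (x - a) + c * \<tau>"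
  using cos_cases c by (auto simp: x'_def algebra_simps)

lemma unfolded_y: "sgn (sin \<theta>) * (y' + a) = sgn (sin \<theta>) * (y + a) + s * \<tau>"
  using sin_cases s by (auto simp: y'_def algebra_simps)

lemma bounce_gauge_step:
  "bounce_gauge ((x, y), \<eta>, \<theta>) + real K \<le> bounce_gauge (bounce K h ((x, y), \<eta>, \<theta>)) + c * \<tau>"
proof (cases rule: bounce_cases)
  case floor
  then show ?thesis using unfolded_x[of "real K / 2"]
    by (simp add: card_missing' del: bounce.simps)
next
  case wall
  have "sgn (cos \<theta>) * (x' - real K / 2) = real K / 2"
    using wall(3) cos_nonzero by (auto simp: sgn_if)
  then show ?thesis using unfolded_x[of "real K / 2"] wall(1,2)
    by (simp add: card_missing' sgn_minus del: bounce.simps)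
next
  case (bottom i)
  then have "present K \<eta>' \<noteq> present K \<eta>" by (auto simp: lowest_row_def)
  then show ?thesis using unfolded_x[of "real K / 2"] bottom(1,4)
    by (simp add: card_missing' algebra_simps del: bounce.simps)
next
  case (side i)
  then have "present K \<eta>' \<noteq> present K \<eta>" by (auto simp: lowest_row_def)
  moreover have "- (real K / 2) \<le> sgn (cos \<theta>) * (x' - real K / 2)"
    using end_strip by (auto simp: sgn_if)
  ultimately show ?thesis using unfolded_x[of "real K / 2"] side(1,4)
    by (simp add: card_missing' sgn_minus distrib_left del: bounce.simps)
qed

lemma rise_gauge_step:
  assumes m: "real H \<le> m"
  shows "rise_gauge m ((x, y), \<eta>, \<theta>) + s * \<tau> \<le> rise_gauge m (bounce K h ((x, y), \<eta>, \<theta>))"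
proof (cases rule: bounce_cases)
  case floor
  then show ?thesis using unfolded_y[of h] by (simp add: card_missing' del: bounce.simps)
next
  case wall
  then show ?thesis using unfolded_y[of h] by (simp add: card_missing' del: bounce.simps)
next
  case (bottom i)
  then have "present K \<eta>' \<noteq> present K \<eta>" by (auto simp: lowest_row_def)
  then show ?thesis using unfolded_y[of h] bottom(1,4,5) m
    by (simp add: card_missing' distrib_left del: bounce.simps)
next
  case (side i)
  then have "present K \<eta>' \<noteq> present K \<eta>" by (auto simp: lowest_row_def)
  then show ?thesis using unfolded_y[of h] side(1) m h
    by (simp add: card_missing' distrib_left del: bounce.simps)
qed

end

section \<open>The trajectory\<close>

locale shot = shallow_shot +
  fixes x0 :: "real \<times> real" and \<eta>0 :: config and \<theta>0 :: real
  assumes start: "(x0, \<eta>0, \<theta>0) \<in> B_star K h"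
    and cos0: "cos \<theta>0 = c" and sin0: "sin \<theta>0 = s"
begin

abbreviation S :: "nat \<Rightarrow> state" where "S \<equiv> after_bounces K h (x0, \<eta>0, \<theta>0)"
abbreviation T :: "nat \<Rightarrow> real" where "T \<equiv> bounce_time K h (x0, \<eta>0, \<theta>0)"
abbreviation conf :: "nat \<Rightarrow> config" where "conf n \<equiv> fst (snd (S n))"
abbreviation row :: "nat \<Rightarrow> nat" where "row n \<equiv> lowest_brick K (conf n)"

lemma S_0: "S 0 = (x0, \<eta>0, \<theta>0)" and S_Suc: "S (Suc n) = bounce K h (S n)"
  and T_0: "T 0 = 0" and T_Suc: "T (Suc n) = T n + hit_time K h (S n)"
  by (simp_all add: after_bounces_def bounce_time_def)

lemma no_vertex: "\<not> hits_vertex K h (S n)"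
  using start by (auto simp: B_star_def regular_def)

lemma confined_S: "confined (S n)"
proof (induction n)
  case 0
  obtain a b where x0: "x0 = (a, b)" by fastforce
  then have "admissible K h ((a, b), \<eta>0, \<theta>0)" "b = - h"
    using start by (auto simp: B_star_def regular_def simp del: admissible.simps)
  then have "confined ((a, b), \<eta>0, \<theta>0)"
    using h cos0 sin0 c s by (intro confined_below) auto
  then show ?case by (simp only: S_0 x0[symmetric])
next
  case (Suc n)
  obtain x y \<eta> \<theta> where S: "S n = ((x, y), \<eta>, \<theta>)" by (metis prod.collapse)
  interpret flight K h c s x y \<eta> \<theta>
    using Suc no_vertex[of n] by unfold_locales (simp_all add: S del: hits_vertex.simps)
  show ?case using confined_bounce by (simp add: S_Suc S del: bounce.simps)
qed

lemma flight_S: "S n = ((x, y), \<eta>, \<theta>) \<Longrightarrow> flight K h c s x y \<eta> \<theta>"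
  using confined_S[of n] no_vertex[of n] by unfold_locales (simp_all del: hits_vertex.simps)

lemma wf_conf: "well_filled K (conf n)"
proof -
  obtain x y \<eta> \<theta> where S: "S n = ((x, y), \<eta>, \<theta>)" by (metis prod.collapse)
  interpret flight K h c s x y \<eta> \<theta> using flight_S[OF S] .
  show ?thesis using wf by (simp add: S)
qed

lemma present_decreasing: "present K (conf (Suc n)) \<subseteq> present K (conf n)"
proof -
  obtain x y \<eta> \<theta> where S: "S n = ((x, y), \<eta>, \<theta>)" by (metis prod.collapse)
  interpret flight K h c s x y \<eta> \<theta> using flight_S[OF S] .
  show ?thesis using present'_subset bounce by (simp add: S S_Suc del: bounce.simps)
qed

lemma row_mono: "n \<le> k \<Longrightarrow> row n \<le> row k"
  by (rule lift_Suc_mono_le) (intro lowest_brick_mono K wf_conf present_decreasing)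

lemma height_time: "0 \<le> T n \<and> snd (fst (S n)) + h \<le> T n"
proof (induction n)
  case 0
  then show ?case using start by (simp add: T_0 S_0 B_star_def)
next
  case (Suc n)
  obtain x y \<eta> \<theta> where S: "S n = ((x, y), \<eta>, \<theta>)" by (metis prod.collapse)
  interpret flight K h c s x y \<eta> \<theta> using flight_S[OF S] .
  have "\<tau> * sin \<theta> \<le> \<tau>" using \<tau>_pos by (intro mult_left_le) auto
  then have "y' \<le> y + \<tau>" by (simp add: y'_def)
  then show ?case
    using Suc \<tau>_pos bounce
    by (auto simp: S S_Suc T_Suc \<tau>_def[symmetric] simp del: bounce.simps hit_time.simps)
qed

text \<open>
  Only bricks of rows that were lowest at some earlier bounce are ever removed, and only at heights
  which the ball had time to reach.
\<close>
lemma missing_conf: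
  "missing K (conf n) \<subseteq>
     missing K \<eta>0 \<union> {z \<in> cells K. snd z \<le> row n \<and> real (snd z) \<le> T n}"
proof (induction n)
  case 0
  then show ?case by (simp add: S_0)
next
  case (Suc n)
  obtain x y \<eta> \<theta> where S: "S n = ((x, y), \<eta>, \<theta>)" by (metis prod.collapse)
  interpret flight K h c s x y \<eta> \<theta> using flight_S[OF S] .
  have after: "conf (Suc n) = \<eta>'" "fst (S (Suc n)) = (x', y')"
    using bounce by (simp_all add: S S_Suc del: bounce.simps)
  have "y' \<le> T (Suc n)" using height_time[of "Suc n"] h by (simp add: after)
  moreover have "T n \<le> T (Suc n)" using \<tau>_pos by (simp add: T_Suc S \<tau>_def del: hit_time.simps)
  ultimately show ?case
    using Suc missing'_subset lowest_mono by (fastforce simp: after S)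
qed

lemma finite_cells_below: "finite {z \<in> cells K. real (snd z) \<le> r}"
proof (rule finite_subset)
  show "{z \<in> cells K. real (snd z) \<le> r} \<subseteq> {..<K} \<times> {..nat \<lceil>r\<rceil>}"
    by (auto simp: cells_def) linarith
qed simp

lemma bounce_gauge_growth: "bounce_gauge (S 0) + real K * real n \<le> bounce_gauge (S n) + c * T n"
proof (induction n)
  case 0
  then show ?case by (simp add: T_0)
next
  case (Suc n)
  obtain x y \<eta> \<theta> where S: "S n = ((x, y), \<eta>, \<theta>)" by (metis prod.collapse)
  interpret flight K h c s x y \<eta> \<theta> using flight_S[OF S] .
  show ?case
    using Suc bounce_gauge_step
    by (simp add: S S_Suc T_Suc \<tau>_def[symmetric] distrib_left
        del: bounce.simps hit_time.simps bounce_gauge.simps)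
qed

lemma bounce_gauge_le: "bounce_gauge (S n) \<le> 2 * real K + 2 * real K * real (card (missing K (conf n)))"
proof -
  obtain x y \<eta> \<theta> where S: "S n = ((x, y), \<eta>, \<theta>)" by (metis prod.collapse)
  interpret flight K h c s x y \<eta> \<theta> using flight_S[OF S] .
  have "- (sgn (cos \<theta>) * (x - real K / 2)) \<le> real K"
    using start_strip by (auto simp: sgn_if)
  moreover have "real K * of_bool (0 < sin \<theta>) \<le> real K" by simp
  ultimately show ?thesis by (simp add: S)
qed

text \<open>
  Bounces do not accumulate: in bounded time the ball reaches only finitely many bricks, so the gauge
  bounds the number of bounces.
\<close>
lemma bounce_times_unbounded: "\<exists>n. t < T (Suc n)"
proof (rule ccontr)
  assume "\<not> ?thesis"
  then have T_le: "T (Suc n) \<le> t" for n by (meson not_le)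
  define C where "C = missing K \<eta>0 \<union> {z \<in> cells K. real (snd z) \<le> t}"
  have "finite C"
    using wf_conf[of 0] finite_cells_below by (simp add: C_def S_0 well_filled_def)
  have "real K * real (Suc n) \<le> 2 * real K + 2 * real K * real (card C) + c * t - bounce_gauge (S 0)" for n
  proof -
    have "missing K (conf (Suc n)) \<subseteq> C"
      using missing_conf[of "Suc n"] T_le[of n] by (auto simp: C_def)
    then have "card (missing K (conf (Suc n))) \<le> card C" using \<open>finite C\<close> card_mono by blast
    then have "2 * real K * real (card (missing K (conf (Suc n)))) \<le> 2 * real K * real (card C)"
      by (intro mult_left_mono) auto
    moreover have "c * T (Suc n) \<le> c * t" using T_le c by simp
    ultimately show ?thesis
      using bounce_gauge_growth[of "Suc n"] bounce_gauge_le[of "Suc n"] by linarith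
  qed
  moreover have "real (Suc n) \<le> real K * real (Suc n)" for n using K by simp
  ultimately have "real (Suc n) \<le> 2 * real K + 2 * real K * real (card C) + c * t - bounce_gauge (S 0)" for n
    by (meson order_trans)
  then show False
    using reals_Archimedean2[of "2 * real K + 2 * real K * real (card C) + c * t - bounce_gauge (S 0)"]
    by (smt (verit) of_nat_Suc)
qed

lemma rise_gauge_growth:
  "row n \<le> m \<Longrightarrow> rise_gauge m (S 0) + s * T n \<le> rise_gauge m (S n)"
proof (induction n)
  case 0
  then show ?case by (simp add: T_0)
next
  case (Suc n)
  obtain x y \<eta> \<theta> where S: "S n = ((x, y), \<eta>, \<theta>)" by (metis prod.collapse)
  interpret flight K h c s x y \<eta> \<theta> using flight_S[OF S] .
  have m: "lowest_brick K \<eta> \<le> m" using Suc.prems row_mono[of n "Suc n"] by (simp add: S)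
  then show ?case
    using Suc.IH rise_gauge_step[of m]
    by (simp add: S S_Suc T_Suc \<tau>_def[symmetric] distrib_left
        del: bounce.simps hit_time.simps rise_gauge.simps)
qed

text \<open>
  While a row below \<open>m\<close> is nonempty, at most \<open>K * m\<close> bricks have been removed and the ball is
  at height at most \<open>m\<close>, so \<open>rise_gauge\<close> bounds the elapsed time independently of the configuration.
  The bound includes the current flight, because the flow shows \<open>conf n\<close> up to time \<open>T (Suc n)\<close>.
\<close>
lemma clearing_time:
  assumes "row n < m"
  shows "s * T (Suc n) \<le> (real m + h) * (1 + 2 * real K * real m)"
proof -
  obtain x y \<eta> \<theta> where S: "S n = ((x, y), \<eta>, \<theta>)" by (metis prod.collapse)
  interpret flight K h c s x y \<eta> \<theta> using flight_S[OF S] .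
  have low: "lowest_brick K \<eta> < m" using assms by (simp add: S)
  have fin: "finite (missing K \<eta>0)" using wf_conf[of 0] by (simp add: S_0 well_filled_def)
  have "missing K \<eta> \<subseteq> missing K \<eta>0 \<union> {..<K} \<times> {..<m}"
    using missing_conf[of n] low by (auto simp: S cells_def)
  then have "card (missing K \<eta>) \<le> card (missing K \<eta>0 \<union> {..<K} \<times> {..<m})"
    using fin by (intro card_mono) auto
  also have "\<dots> \<le> card (missing K \<eta>0) + K * m"
    using card_Un_le[of "missing K \<eta>0" "{..<K} \<times> {..<m}"] by (simp add: card_cartesian_product)
  finally have "real (card (missing K \<eta>)) \<le> real (card (missing K \<eta>0)) + real K * real m"
    by (metis of_nat_add of_nat_le_iff of_nat_mult)
  then have "2 * (real m + h) * real (card (missing K \<eta>))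
      \<le> 2 * (real m + h) * (real (card (missing K \<eta>0)) + real K * real m)"
    using h by (intro mult_left_mono) auto
  moreover have "rise_gauge m (S 0) = 2 * (real m + h) * real (card (missing K \<eta>0))"
  proof -
    obtain a where x0: "x0 = (a, - h)" using start by (cases x0) (auto simp: B_star_def)
    have "0 < sin \<theta>0" using sin0 s by simp
    then have "rise_gauge m ((a, - h), \<eta>0, \<theta>0) = 2 * (real m + h) * real (card (missing K \<eta>0))"
      by simp
    then show ?thesis by (simp only: S_0 x0[symmetric])
  qed
  then have "2 * (real m + h) * real (card (missing K \<eta>0)) + s * T n
      \<le> sgn (sin \<theta>) * (y + h) + 2 * (real m + h) * real (card (missing K \<eta>))"
    using rise_gauge_growth[of n m] low by (simp add: S)
  moreover have "sgn (sin \<theta>) * (y + h) + s * \<tau> \<le> real m + h"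
    unfolding unfolded_y[symmetric]
    using end_below end_strip(3) low h by (auto simp: sgn_if)
  moreover have "s * T (Suc n) = s * T n + s * \<tau>"
    by (simp add: T_Suc S \<tau>_def distrib_left del: hit_time.simps)
  ultimately show ?thesis by (simp add: algebra_simps)
qed

text \<open>
  Since removals happen in the lowest nonempty row only, a gap higher than the initial ones lies
  at most in that row.
\<close>
lemma highest_gap_conf: "highest_gap K (conf n) \<le> max (highest_gap K \<eta>0) (row n + 1)"
proof (cases "missing K (conf n) = {}")
  case True
  then show ?thesis by (simp add: highest_gap_def)
next
  case False
  have fin: "finite (missing K (conf n))" using wf_conf by (simp add: well_filled_def)
  have fin0: "finite (missing K \<eta>0)" using wf_conf[of 0] by (simp add: S_0 well_filled_def)
  have "Max (snd ` missing K (conf n)) \<in> snd ` missing K (conf n)"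
    using False fin by (intro Max_in) auto
  then obtain z where z: "z \<in> missing K (conf n)" "Max (snd ` missing K (conf n)) = snd z" by auto
  then have "z \<in> missing K \<eta>0 \<or> snd z \<le> row n" using missing_conf by auto
  moreover have "1 + snd z \<le> highest_gap K \<eta>0" if "z \<in> missing K \<eta>0"
    using that fin0 by (auto simp: highest_gap_def)
  moreover have "highest_gap K (conf n) = 1 + snd z" using False z(2) by (simp add: highest_gap_def)
  ultimately show ?thesis by auto
qed

lemma balanced_conf:
  assumes "highest_gap K \<eta>0 \<le> row n + 1"
  shows "balanced K (conf n)"
  using highest_gap_conf[of n] assms wf_conf[of n] by (simp add: balanced_def)

lemma config_at_conf:
  obtains n where "config_at K h t (x0, \<eta>0, \<theta>0) = conf n" "t < T (Suc n)"
proof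
  let ?n = "LEAST n. t < T (Suc n)"
  show "config_at K h t (x0, \<eta>0, \<theta>0) = conf ?n"
    by (simp add: config_at_def flow_def Let_def split: prod.split)
  show "t < T (Suc ?n)"
    using bounce_times_unbounded by (rule LeastI_ex)
qed

lemma stays_balanced:
  assumes "balanced K \<eta>0"
  shows "balanced K (config_at K h t (x0, \<eta>0, \<theta>0))"
proof -
  obtain n where n: "config_at K h t (x0, \<eta>0, \<theta>0) = conf n" by (rule config_at_conf)
  have "highest_gap K \<eta>0 \<le> lowest_brick K \<eta>0 + 1" using assms by (simp add: balanced_def)
  then show ?thesis using row_mono[of 0 n] n by (simp add: S_0 balanced_conf)
qed

lemma becomes_balanced:
  assumes "m = highest_gap K \<eta>0" "(real m + h) * (1 + 2 * real K * real m) \<le> s * t"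
  shows "balanced K (config_at K h t (x0, \<eta>0, \<theta>0))"
proof -
  obtain n where n: "config_at K h t (x0, \<eta>0, \<theta>0) = conf n" "t < T (Suc n)"
    by (rule config_at_conf)
  have "m \<le> row n"
  proof (rule ccontr)
    assume "\<not> m \<le> row n"
    then have "s * T (Suc n) \<le> s * t" using clearing_time[of n m] assms(2) by simp
    then show False using n(2) s by simp
  qed
  then show ?thesis using n(1) assms(1) by (simp add: balanced_conf)
qed

end

section \<open>The threshold angle\<close>

lemma shallow_angle:
  assumes K: "1 \<le> K" and \<theta>: "0 < \<theta>"
    "\<theta> < (if K = 1 then pi / 2 else arctan (1 / (real K * (real K - 1))))"
    and h: "0 \<le> h"
  shows "shallow_shot K h (cos \<theta>) (sin \<theta>)"
proof
  have lt: "\<theta> < pi / 2"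
    using \<theta>(2) arctan_ubound[of "1 / (real K * (real K - 1))"] by (auto split: if_splits)
  show "0 < sin \<theta>" using \<theta>(1) lt by (intro sin_gt_zero) auto
  show c: "0 < cos \<theta>" using \<theta>(1) lt by (intro cos_gt_zero_pi) auto
  show "sin \<theta> * (real K * (real K - 1)) < cos \<theta>"
  proof (cases "K = 1")
    case True
    then show ?thesis using c by simp
  next
    case False
    then have pos: "0 < real K * (real K - 1)" using K by simp
    have "tan \<theta> < tan (arctan (1 / (real K * (real K - 1))))"
      using \<theta> False lt arctan_ubound by (intro tan_monotone) auto
    then have "tan \<theta> < 1 / (real K * (real K - 1))" by (simp only: tan_arctan)
    then have "sin \<theta> / cos \<theta> < 1 / (real K * (real K - 1))" by (simp add: tan_def)
    then show ?thesis using pos c by (simp add: divide_less_eq less_divide_eq mult.commute)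
  qed
qed (use K h in auto)

theorem mainTheorem3:
  "\<exists>\<theta>s :: nat \<Rightarrow> real.
     (\<forall>K\<ge>1.
        0 < \<theta>s K \<and>
        (\<forall>\<theta>0. 0 < \<theta>0 \<and> \<theta>0 < \<theta>s K \<longrightarrow>
           (\<forall>h\<ge>0. \<forall>\<eta>0. balanced K \<eta>0 \<longrightarrow>
              (\<forall>x0. (x0, \<eta>0, \<theta>0) \<in> B_star K h \<longrightarrow>
                 (\<forall>t\<ge>0. balanced K (config_at K h t (x0, \<eta>0, \<theta>0)))))) \<and>
        (\<forall>\<theta>0. 0 < \<theta>0 \<and> \<theta>0 < \<theta>s K \<longrightarrow>
           (\<forall>h\<ge>0. \<exists>t0 :: nat \<Rightarrow> real. (\<forall>m. 0 < t0 m) \<and>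
              (\<forall>\<eta>0. well_filled K \<eta>0 \<longrightarrow>
                 (\<forall>x0. (x0, \<eta>0, \<theta>0) \<in> B_star K h \<longrightarrow>
                    balanced K (config_at K h (t0 (highest_gap K \<eta>0)) (x0, \<eta>0, \<theta>0)))))) \<and>
        \<theta>s K = (if K = 1 then pi / 2 else arctan (1 / (real K * (real K - 1))))) \<and>
     \<theta>s 2 = arctan (1 / 2)"
proof -
  define \<theta>s :: "nat \<Rightarrow> real" where
    "\<theta>s K = (if K = 1 then pi / 2 else arctan (1 / (real K * (real K - 1))))" for K
  have shot: "shot K h (cos \<theta>0) (sin \<theta>0) x0 \<eta>0 \<theta>0"
    if "1 \<le> K" "0 < \<theta>0" "\<theta>0 < \<theta>s K" "0 \<le> h" "(x0, \<eta>0, \<theta>0) \<in> B_star K h" for K \<theta>0 h x0 \<eta>0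
    using shallow_angle[of K \<theta>0 h] that
    by (auto simp: \<theta>s_def shot_def shot_axioms_def)
  have pos: "0 < \<theta>s K" if "1 \<le> K" for K
    using that by (auto simp: \<theta>s_def zero_less_arctan_iff)
  have part2: "\<exists>t0 :: nat \<Rightarrow> real. (\<forall>m. 0 < t0 m) \<and>
      (\<forall>\<eta>0. well_filled K \<eta>0 \<longrightarrow> (\<forall>x0. (x0, \<eta>0, \<theta>0) \<in> B_star K h \<longrightarrow>
         balanced K (config_at K h (t0 (highest_gap K \<eta>0)) (x0, \<eta>0, \<theta>0))))"
    if "1 \<le> K" "0 < \<theta>0" "\<theta>0 < \<theta>s K" "0 \<le> h" for K \<theta>0 h
  proof -
    have s: "0 < sin \<theta>0"
      using shallow_angle[of K \<theta>0 h] that by (simp add: \<theta>s_def shallow_shot_def)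
    \<comment> \<open>The summand 1 only serves to make the time positive when \<open>m = 0\<close> and \<open>h = 0\<close>.\<close>
    define t0 where "t0 m = (real m + h + 1) * (1 + 2 * real K * real m) / sin \<theta>0" for m :: nat
    have t0: "0 < t0 m" "(real m + h) * (1 + 2 * real K * real m) \<le> sin \<theta>0 * t0 m" for m
      using s \<open>0 \<le> h\<close> by (auto simp: t0_def add_nonneg_pos add_pos_nonneg distrib_right)
    show ?thesis
      using t0 shot[OF that] shot.becomes_balanced by blast
  qed
  have "balanced K (config_at K h t (x0, \<eta>0, \<theta>0))"
    if "1 \<le> K" "0 < \<theta>0 \<and> \<theta>0 < \<theta>s K" "0 \<le> h" "balanced K \<eta>0" "(x0, \<eta>0, \<theta>0) \<in> B_star K h"
    for K \<theta>0 h \<eta>0 x0 t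
    using that by (intro shot.stays_balanced[OF shot]) auto
  moreover have "\<theta>s 2 = arctan (1 / 2)" by (simp add: \<theta>s_def)
  ultimately show ?thesis using pos part2 \<theta>s_def by (intro exI[of _ \<theta>s]) blast
qed

end
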